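(* Let $$A=\left(0,0,0,\tfrac{4}{\sqrt5}\right),\quad B=\left(1,1,1,-\tfrac{1}{\sqrt5}\right),\quad C=\left(1,-1,-1,-\tfrac{1}{\sqrt5}\right),$$ $$D=\left(-1,1,-1,-\tfrac{1}{\sqrt5}\right),\quad E=\left(-1,-1,1,-\tfrac{1}{\sqrt5}\right),\quad O=(0,0,0,0)$$ be points in $\mathbb{R}^4$, and let $K_6$ be the vertex-labeled complete graph on the vertex set $\{A,B,C,D,E,O\}$. Then all the twelve triangulations of the 2-dimensional (real) projective plane with the vertex-labeled complete graph $K_6$ are realized geometrically in $\mathbb{R}^4$ with the same 1-skeleton, the six vertices being placed at the points given above. That is, for every triangulation $T$ of the projective plane with this vertex-labeled graph, placing each vertex at the point of the same name, each edge as the straight segment between its endpoints, and each face as the convex hull of its three vertices yields a geometric realization of $T$ in $\mathbb{R}^4$.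
   Context: A triangulation of a closed surface $S$ with a vertex-labeled graph $\Gamma$ is an abstract 2-dimensional simplicial complex whose underlying space is homeomorphic to $S$ and whose 1-skeleton is exactly the labeled graph $\Gamma$ (same labeled vertices, same edges). Its faces are its 2-simplices, regarded as 3-element sets of labeled vertices. Two triangulations with the same vertex-labeled graph are considered different if their face sets differ. It is known that there are precisely twelve pairwise different triangulations of the projective plane with the vertex-labeled graph $K_6$. A geometric realization of an abstract triangulation $T$ in $\mathbb{R}^n$ is a polyhedron in $\mathbb{R}^n$, all of whose faces are (nondegenerate) geometric simplices, whose polyhedral structure is isomorphic to $T$ and which is free from self-intersections. Equivalently, vertices are represented by points, each simplex of $T$ is represented by the convex hull of its vertices, and any two such geometric simplices intersect exactly in the geometric simplex spanned by their common vertices (or are disjoint if they have no common vertex). *)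

theory Defs
  imports "HOL-Analysis.Analysis"
begin

(* The empty simplex is not a member; the vertex set of K is \<Union>K. *)
definition abstract_complex :: "'v set set \<Rightarrow> bool" where
  "abstract_complex K \<longleftrightarrow> finite K \<and>
     (\<forall>s\<in>K. finite s \<and> s \<noteq> {}) \<and>
     (\<forall>s\<in>K. \<forall>t. t \<subseteq> s \<and> t \<noteq> {} \<longrightarrow> t \<in> K)"

definition two_dimensional :: "'v set set \<Rightarrow> bool" where
  "two_dimensional K \<longleftrightarrow> (\<forall>s\<in>K. card s \<le> 3) \<and> (\<exists>s\<in>K. card s = 3)"

(* Points are given by barycentric coordinates.  Since complexes are finite, the product topology
   induces the usual topology on the underlying space. *)
definition underlying_space :: "'v set set \<Rightarrow> ('v \<Rightarrow> real) topology" where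
  "underlying_space K = subtopology (powertop_real UNIV)
     {x. (\<forall>v. 0 \<le> x v) \<and> {v. x v \<noteq> 0} \<in> K \<and> (\<Sum>v | x v \<noteq> 0. x v) = 1}"

(* A simple graph: its vertex set and its set of two-element edges. *)
type_synonym 'v graph = "'v set \<times> 'v set set"

definition complete_graph :: "'v set \<Rightarrow> 'v graph" where
  "complete_graph V = (V, {e. e \<subseteq> V \<and> card e = 2})"

definition one_skeleton :: "'v set set \<Rightarrow> 'v graph" where
  "one_skeleton K = (\<Union>K, {e \<in> K. card e = 2})"

(* A complex with a fixed 1-skeleton is determined by its 2-simplices, so distinct members of this
   set are exactly the triangulations with distinct sets of faces. *)
definition triangulations_with_graph :: "'s topology \<Rightarrow> 'v graph \<Rightarrow> 'v set set set" where
  "triangulations_with_graph S G =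
     {K. abstract_complex K \<and> two_dimensional K \<and>
         underlying_space K homeomorphic_space S \<and> one_skeleton K = G}"

(* The 2-sphere with antipodal points identified, with the quotient topology. *)
definition projective_plane :: "(real ^ 3) set topology" where
  "projective_plane = topology (\<lambda>U. U \<subseteq> (\<lambda>x. {x, - x}) ` sphere 0 1 \<and>
     openin (top_of_set (sphere 0 1)) {x \<in> sphere 0 1. {x, - x} \<in> U})"

lemma openin_projective_plane:
  "openin projective_plane U \<longleftrightarrow> U \<subseteq> (\<lambda>x. {x, - x}) ` sphere 0 1 \<and>
     openin (top_of_set (sphere 0 1)) {x \<in> sphere 0 1. {x, - x} \<in> U}"
proof -
  let ?S = "sphere (0 :: real ^ 3) 1"
  let ?P = "\<lambda>U. U \<subseteq> (\<lambda>x. {x, - x}) ` ?S \<and> openin (top_of_set ?S) {x \<in> ?S. {x, - x} \<in> U}"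
  have "istopology ?P"
    unfolding istopology_def
  proof (intro conjI allI impI)
    fix U V assume "?P U" "?P V"
    moreover have "{x \<in> ?S. {x, - x} \<in> U \<inter> V} =
        {x \<in> ?S. {x, - x} \<in> U} \<inter> {x \<in> ?S. {x, - x} \<in> V}" by blast
    ultimately show "U \<inter> V \<subseteq> (\<lambda>x. {x, - x}) ` ?S"
      and "openin (top_of_set ?S) {x \<in> ?S. {x, - x} \<in> U \<inter> V}" by auto
  next
    fix \<K> assume K: "\<forall>U\<in>\<K>. ?P U"
    then show "\<Union>\<K> \<subseteq> (\<lambda>x. {x, - x}) ` ?S" by blast
    have "{x \<in> ?S. {x, - x} \<in> \<Union>\<K>} = (\<Union>U\<in>\<K>. {x \<in> ?S. {x, - x} \<in> U})" by blast
    then show "openin (top_of_set ?S) {x \<in> ?S. {x, - x} \<in> \<Union>\<K>}" using K by auto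
  qed
  then show ?thesis
    unfolding projective_plane_def by simp
qed

lemma topspace_projective_plane: "topspace projective_plane = (\<lambda>x. {x, - x}) ` sphere 0 1"
proof
  show "topspace projective_plane \<subseteq> (\<lambda>x. {x, - x}) ` sphere 0 1"
    using openin_projective_plane openin_topspace by blast
  have "{x \<in> sphere (0 :: real ^ 3) 1. {x, - x} \<in> (\<lambda>x. {x, - x}) ` sphere 0 1} = sphere 0 1"
    by blast
  then have "openin projective_plane ((\<lambda>x. {x, - x}) ` sphere 0 1)"
    unfolding openin_projective_plane by (metis openin_subtopology_self subset_refl)
  then show "(\<lambda>x. {x, - x}) ` sphere 0 1 \<subseteq> topspace projective_plane"
    by (rule openin_subset)
qed

lemma quotient_map_projective_plane:
  "quotient_map (top_of_set (sphere 0 1)) projective_plane (\<lambda>x. {x, - x})"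
  by (simp add: quotient_map_def topspace_projective_plane openin_projective_plane)

(* The condition on a single simplex is nondegeneracy; the other one excludes
   self-intersections and, for disjoint s and t, says that the two hulls are disjoint. *)
definition geometric_realization :: "('v \<Rightarrow> 'a::euclidean_space) \<Rightarrow> 'v set set \<Rightarrow> bool" where
  "geometric_realization p K \<longleftrightarrow>
     (\<forall>s\<in>K. (int (card s) - 1) simplex (convex hull (p ` s))) \<and>
     (\<forall>s\<in>K. \<forall>t\<in>K.
        convex hull (p ` s) \<inter> convex hull (p ` t) = convex hull (p ` (s \<inter> t)))"

definition geometric_one_skeleton :: "('v \<Rightarrow> 'a::euclidean_space) \<Rightarrow> 'v set set \<Rightarrow> 'a set" where
  "geometric_one_skeleton p K = (\<Union>s\<in>{s \<in> K. card s \<le> 2}. convex hull (p ` s))"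

datatype vertex = VA | VB | VC | VD | VE | VO

fun position :: "vertex \<Rightarrow> real ^ 4" where
  "position VA = vector [0, 0, 0, 4 / sqrt 5]"
| "position VB = vector [1, 1, 1, - 1 / sqrt 5]"
| "position VC = vector [1, - 1, - 1, - 1 / sqrt 5]"
| "position VD = vector [- 1, 1, - 1, - 1 / sqrt 5]"
| "position VE = vector [- 1, - 1, 1, - 1 / sqrt 5]"
| "position VO = vector [0, 0, 0, 0]"

lemma vector_4 [simp]:
  fixes a b c d :: "'a::zero"
  shows "(vector [a, b, c, d] :: 'a ^ 4) $ 1 = a" "(vector [a, b, c, d] :: 'a ^ 4) $ 2 = b"
    "(vector [a, b, c, d] :: 'a ^ 4) $ 3 = c" "(vector [a, b, c, d] :: 'a ^ 4) $ 4 = d"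
  unfolding vector_def by simp_all

end

theory Submission
  imports Defs
begin

text \<open>
  The points \<open>A\<close>, ..., \<open>E\<close> are the vertices of a 4-simplex and \<open>O\<close> is its barycentre.  Six points
  that affinely span a 4-space have, up to a scalar, exactly one affine dependence; here it is
  \<open>A + B + C + D + E - 5 O = 0\<close> (\<open>position_affine_dependence\<close>).  If the hulls of two
  vertex sets met outside the hull of their common vertices, then subtracting two barycentric
  representations of a common point would give a nonzero affine dependence whose positive
  coefficients lie in one set and whose negative coefficients lie in the other.  One of the two sets
  would therefore contain all of \<open>A\<close>, ..., \<open>E\<close>, but a simplex of a triangulated surface has at most
  three vertices.  Degenerate simplices are excluded in the same way.

  The first part of this argument works for every point configuration in which each nonzero affine
  dependence has more than \<open>d\<close> coefficients of one sign: such a configuration realizes every complex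
  whose simplices have at most \<open>d\<close> vertices (\<open>geometric_realization_if_sign_imbalanced\<close>).
  The segments of the common 1-skeleton are those of the complete graph, which every one of the
  triangulations contains.
\<close>

section \<open>Realizing complexes in configurations with unbalanced affine dependences\<close>

text \<open>
  This is a condition on the sign patterns of affine dependences (the oriented matroid of
  the configuration).  A Radon partition has the positive vertices on one side and the negative
  ones on the other, so the condition says that one side of each Radon partition has more than
  \<open>d\<close> points.
\<close>

definition sign_imbalanced :: "nat \<Rightarrow> ('v \<Rightarrow> 'a::real_vector) \<Rightarrow> 'v set \<Rightarrow> bool" where
  "sign_imbalanced d p V \<longleftrightarrow>
     (\<forall>c. sum c V = 0 \<longrightarrow> (\<Sum>v\<in>V. c v *\<^sub>R p v) = 0 \<longrightarrow> (\<exists>v\<in>V. c v \<noteq> 0) \<longrightarrow>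
        d < card {v \<in> V. 0 < c v} \<or> d < card {v \<in> V. c v < 0})"

lemma affine_dependence_eq_0:
  assumes p: "sign_imbalanced d p V" and V: "finite V" "s \<subseteq> V" "t \<subseteq> V"
    and card: "card s \<le> d" "card t \<le> d"
    and c: "sum c V = 0" "(\<Sum>v\<in>V. c v *\<^sub>R p v) = 0"
    and pos: "\<And>v. v \<in> V \<Longrightarrow> 0 < c v \<Longrightarrow> v \<in> s"
    and neg: "\<And>v. v \<in> V \<Longrightarrow> c v < 0 \<Longrightarrow> v \<in> t"
    and "v \<in> V"
  shows "c v = 0"
proof (rule ccontr)
  assume "c v \<noteq> 0"
  then have "d < card {v \<in> V. 0 < c v} \<or> d < card {v \<in> V. c v < 0}"
    using p c \<open>v \<in> V\<close> unfolding sign_imbalanced_def by blast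
  moreover have "card {v \<in> V. 0 < c v} \<le> card s" "card {v \<in> V. c v < 0} \<le> card t"
    using pos neg V by (auto intro!: card_mono intro: finite_subset)
  ultimately show False
    using card by linarith
qed

lemma sign_imbalanced_inj_on:
  assumes p: "sign_imbalanced d p V" and V: "finite V" "s \<subseteq> V" and card: "card s \<le> d"
  shows "inj_on p s"
proof (rule inj_onI, rule ccontr)
  fix u v assume uv: "u \<in> s" "v \<in> s" "p u = p v" "u \<noteq> v"
  \<comment> \<open>Two vertices at the same point satisfy the affine dependence \<open>u - v = 0\<close>.\<close>
  define c :: "'a \<Rightarrow> real" where "c = (\<lambda>w. of_bool (w = u) - of_bool (w = v))"
  have uvV: "u \<in> V" "v \<in> V"
    using uv V by auto
  have "sum c V = 0"
    using V(1) uvV by (simp add: c_def sum_subtractf of_bool_def)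
  moreover have "(\<Sum>w\<in>V. c w *\<^sub>R p w) = 0"
    using V(1) uvV uv
    by (simp add: c_def sum_subtractf scaleR_diff_left of_bool_def if_distrib[of "\<lambda>r. r *\<^sub>R _"] cong: if_cong)
  moreover have "w \<in> s" if "0 < c w \<or> c w < 0" for w
    using that uv by (auto simp: c_def of_bool_def split: if_splits)
  ultimately have "c u = 0"
    using affine_dependence_eq_0[OF p V(1) V(2) V(2) card card] uvV by blast
  then show False
    using uv by (simp add: c_def)
qed

lemma sign_imbalanced_affine_independent:
  assumes p: "sign_imbalanced d p V" and V: "finite V" "s \<subseteq> V" and card: "card s \<le> d"
  shows "\<not> affine_dependent (p ` s)"
proof
  assume "affine_dependent (p ` s)"
  moreover have fin: "finite s"
    using V finite_subset by blast
  ultimately obtain U x where U: "sum U (p ` s) = 0" "(\<Sum>x\<in>p ` s. U x *\<^sub>R x) = 0"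
    and x: "x \<in> p ` s" "U x \<noteq> 0"
    by (auto simp: affine_dependent_explicit_finite)
  then obtain v where v: "v \<in> s" "x = p v"
    by blast
  have inj: "inj_on p s"
    using sign_imbalanced_inj_on[OF p V card] .
  define c where "c = (\<lambda>w. if w \<in> s then U (p w) else 0)"
  have "sum c V = 0"
    using U(1) V by (simp add: c_def sum.If_cases Int_absorb1 sum.reindex[OF inj])
  moreover have "(\<Sum>w\<in>V. c w *\<^sub>R p w) = 0"
    using U(2) V
    by (simp add: c_def if_distrib[of "\<lambda>r. r *\<^sub>R _"] sum.If_cases Int_absorb1 sum.reindex[OF inj]
        cong: if_cong)
  moreover have "w \<in> s" if "0 < c w \<or> c w < 0" for w
    using that by (auto simp: c_def split: if_splits)
  ultimately have "c v = 0"
    using affine_dependence_eq_0[OF p V(1) V(2) V(2) card card] v V by blast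
  then show False
    using x v by (simp add: c_def)
qed

text \<open>
  Extending barycentric coordinates by zero to a common vertex set \<open>V\<close> makes the coordinates of one
  point with respect to different simplices comparable.
\<close>

lemma convex_hull_image_coordinates:
  fixes p :: "'v \<Rightarrow> 'a::real_vector"
  assumes "finite V" "s \<subseteq> V" "inj_on p s" "x \<in> convex hull (p ` s)"
  obtains a where "\<And>v. 0 \<le> a v" "\<And>v. v \<notin> s \<Longrightarrow> a v = 0" "sum a V = 1"
    "(\<Sum>v\<in>V. a v *\<^sub>R p v) = x"
proof -
  have "finite (p ` s)"
    using assms finite_subset by blast
  then obtain u where u: "\<forall>y\<in>p ` s. 0 \<le> u y" "sum u (p ` s) = 1" "(\<Sum>y\<in>p ` s. u y *\<^sub>R y) = x"
    using assms(4) by (auto simp: convex_hull_finite)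
  define a where "a = (\<lambda>w. if w \<in> s then u (p w) else 0)"
  show thesis
  proof (rule that[of a])
    show "sum a V = 1"
      using u(2) assms(1,2) by (simp add: a_def sum.If_cases Int_absorb1 sum.reindex[OF assms(3)])
    show "(\<Sum>v\<in>V. a v *\<^sub>R p v) = x"
      using u(3) assms(1,2)
      by (simp add: a_def if_distrib[of "\<lambda>r. r *\<^sub>R _"] sum.If_cases Int_absorb1
          sum.reindex[OF assms(3)] cong: if_cong)
  qed (use u(1) in \<open>auto simp: a_def\<close>)
qed

text \<open>
  Two barycentric representations of one point differ by an affine dependence that is positive only
  on \<open>s\<close> and negative only on \<open>t\<close>.  It vanishes, so the two representations agree and are supported
  on the common vertices.
\<close>

lemma sign_imbalanced_convex_hull_Int:
  assumes p: "sign_imbalanced d p V" and V: "finite V" "s \<subseteq> V" "t \<subseteq> V"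
    and card: "card s \<le> d" "card t \<le> d"
  shows "convex hull (p ` s) \<inter> convex hull (p ` t) = convex hull (p ` (s \<inter> t))"
proof
  show "convex hull (p ` s) \<inter> convex hull (p ` t) \<subseteq> convex hull (p ` (s \<inter> t))"
  proof
    fix x assume x: "x \<in> convex hull (p ` s) \<inter> convex hull (p ` t)"
    obtain a where a: "\<And>v. 0 \<le> a v" "\<And>v. v \<notin> s \<Longrightarrow> a v = 0" "sum a V = 1"
      "(\<Sum>v\<in>V. a v *\<^sub>R p v) = x"
      using convex_hull_image_coordinates[OF V(1,2) sign_imbalanced_inj_on[OF p V(1,2) card(1)]] x
      by blast
    obtain b where b: "\<And>v. 0 \<le> b v" "\<And>v. v \<notin> t \<Longrightarrow> b v = 0" "sum b V = 1"
      "(\<Sum>v\<in>V. b v *\<^sub>R p v) = x"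
      using convex_hull_image_coordinates[OF V(1,3) sign_imbalanced_inj_on[OF p V(1,3) card(2)]] x
      by blast
    define c where "c = (\<lambda>v. a v - b v)"
    have c0: "sum c V = 0" "(\<Sum>v\<in>V. c v *\<^sub>R p v) = 0"
      using a(3,4) b(3,4) by (simp_all add: c_def sum_subtractf scaleR_diff_left)
    have pos: "v \<in> s" if "0 < c v" for v
      using that a(2)[of v] b(1)[of v] by (force simp: c_def)
    have neg: "v \<in> t" if "c v < 0" for v
      using that b(2)[of v] a(1)[of v] by (force simp: c_def)
    have "c v = 0" if "v \<in> V" for v
      using affine_dependence_eq_0[OF p V card c0] pos neg that by blast
    then have eq: "a v = b v" if "v \<in> V" for v
      using that by (simp add: c_def)
    have supp: "a v = 0" if "v \<in> V - s \<inter> t" for v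
      using that a(2)[of v] b(2)[of v] eq[of v] by auto
    have st: "finite (s \<inter> t)" "s \<inter> t \<subseteq> V"
      using V by (auto intro: finite_subset[of _ V])
    have "sum a (s \<inter> t) = 1"
      using sum.mono_neutral_left[OF V(1) st(2)] supp a(3) by metis
    then have "(\<Sum>v\<in>s \<inter> t. a v *\<^sub>R p v) \<in> convex hull (p ` (s \<inter> t))"
      using a(1) st(1) by (intro convex_sum) (auto intro: hull_inc)
    moreover have "(\<Sum>v\<in>s \<inter> t. a v *\<^sub>R p v) = x"
      using sum.mono_neutral_left[OF V(1) st(2), of "\<lambda>v. a v *\<^sub>R p v"] supp a(4) by simp
    ultimately show "x \<in> convex hull (p ` (s \<inter> t))"
      by simp
  qed
  show "convex hull (p ` (s \<inter> t)) \<subseteq> convex hull (p ` s) \<inter> convex hull (p ` t)"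
    by (intro Int_greatest hull_mono image_mono) auto
qed

lemma geometric_realization_if_sign_imbalanced:
  assumes p: "sign_imbalanced d p V" and V: "finite V"
    and K: "\<And>s. s \<in> K \<Longrightarrow> s \<subseteq> V \<and> card s \<le> d"
  shows "geometric_realization p K"
  unfolding geometric_realization_def
proof (intro conjI ballI)
  fix s assume "s \<in> K"
  then have s: "s \<subseteq> V" "card s \<le> d"
    using K by auto
  have "card (p ` s) = card s"
    using sign_imbalanced_inj_on[OF p V s] by (rule card_image)
  then show "(int (card s) - 1) simplex (convex hull (p ` s))"
    using sign_imbalanced_affine_independent[OF p V s] by (auto simp: simplex_def)
next
  fix s t assume "s \<in> K" "t \<in> K"
  then show "convex hull (p ` s) \<inter> convex hull (p ` t) = convex hull (p ` (s \<inter> t))"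
    using K by (intro sign_imbalanced_convex_hull_Int[OF p V]) auto
qed

section \<open>The 4-simplex with its barycentre\<close>

lemma UNIV_vertex: "(UNIV :: vertex set) = {VA, VB, VC, VD, VE, VO}"
  using vertex.exhaust by auto

lemma finite_vertex: "finite (UNIV :: vertex set)"
  by (simp add: UNIV_vertex)

text \<open>
  In the first three coordinates, \<open>B\<close>, ..., \<open>E\<close> are the vertices of a regular tetrahedron centred at
  the origin, while \<open>A\<close> and \<open>O\<close> vanish; this makes the coefficients of \<open>B\<close>, ..., \<open>E\<close> equal.  The last
  coordinate gives the coefficient of \<open>A\<close>, and the zero sum gives that of \<open>O\<close>.
\<close>

lemma position_affine_dependence:
  assumes sum: "sum c UNIV = 0" and dep: "(\<Sum>v\<in>UNIV. c v *\<^sub>R position v) = 0"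
  shows "c v = (if v = VO then - 5 * c VA else c VA)"
proof -
  have coord: "(\<Sum>v\<in>UNIV. c v * position v $ i) = 0" for i
    using arg_cong[OF dep, of "\<lambda>x. x $ i"] by (simp add: sum_component)
  have 1: "c VB + c VC - c VD - c VE = 0"
    using coord[of 1] by (simp add: UNIV_vertex)
  have 2: "c VB - c VC + c VD - c VE = 0"
    using coord[of 2] by (simp add: UNIV_vertex)
  have 3: "c VB - c VC - c VD + c VE = 0"
    using coord[of 3] by (simp add: UNIV_vertex)
  have "(4 * c VA - c VB - c VC - c VD - c VE) / sqrt 5 = 0"
    using coord[of 4] by (simp add: UNIV_vertex field_simps)
  then have 4: "4 * c VA - c VB - c VC - c VD - c VE = 0"
    by simp
  have 5: "c VA + c VB + c VC + c VD + c VE + c VO = 0"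
    using sum by (simp add: UNIV_vertex)
  show ?thesis
    using 1 2 3 4 5 by (cases v) auto
qed

lemma sign_imbalanced_position: "sign_imbalanced 4 position UNIV"
  unfolding sign_imbalanced_def
proof (intro allI impI)
  fix c :: "vertex \<Rightarrow> real"
  assume "sum c UNIV = 0" "(\<Sum>v\<in>UNIV. c v *\<^sub>R position v) = 0" and nz: "\<exists>v\<in>UNIV. c v \<noteq> 0"
  then have c: "c v = (if v = VO then - 5 * c VA else c VA)" for v
    by (rule_tac position_affine_dependence)
  have five: "4 < card X" if "{VA, VB, VC, VD, VE} \<subseteq> X" for X
    using card_mono[OF finite_subset[OF subset_UNIV finite_vertex] that] by simp
  have "c VA \<noteq> 0"
  proof
    assume "c VA = 0"
    then have "c v = 0" for v
      using c[of v] by (simp split: if_splits)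
    then show False
      using nz by blast
  qed
  then consider "0 < c VA" | "c VA < 0"
    by linarith
  then show "4 < card {v \<in> UNIV. 0 < c v} \<or> 4 < card {v \<in> UNIV. c v < 0}"
  proof cases
    case 1
    then have "{VA, VB, VC, VD, VE} \<subseteq> {v \<in> UNIV. 0 < c v}"
      using c[of VB] c[of VC] c[of VD] c[of VE] by simp
    then show ?thesis
      using five by blast
  next
    case 2
    then have "{VA, VB, VC, VD, VE} \<subseteq> {v \<in> UNIV. c v < 0}"
      using c[of VB] c[of VC] c[of VD] c[of VE] by simp
    then show ?thesis
      using five by blast
  qed
qed

section \<open>The 1-skeleton and the triangulations\<close>

lemma geometric_one_skeleton_complete_graph:
  fixes p :: "'v \<Rightarrow> 'a::euclidean_space"
  assumes K: "abstract_complex K" and graph: "one_skeleton K = complete_graph UNIV"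
  shows "geometric_one_skeleton p K = (\<Union>u. \<Union>v. closed_segment (p u) (p v))"
proof
  show "geometric_one_skeleton p K \<subseteq> (\<Union>u. \<Union>v. closed_segment (p u) (p v))"
  proof
    fix x assume "x \<in> geometric_one_skeleton p K"
    then obtain s where s: "s \<in> K" "card s \<le> 2" and x: "x \<in> convex hull (p ` s)"
      by (auto simp: geometric_one_skeleton_def)
    have "finite s" "s \<noteq> {}"
      using K s by (auto simp: abstract_complex_def)
    then have "card s = 1 \<or> card s = 2"
      using s(2) card_gt_0_iff[of s] by linarith
    then obtain u v where "s = {u, v}"
      by (metis card_1_singletonE card_2_iff insert_absorb2)
    then have "x \<in> closed_segment (p u) (p v)"
      using x by (simp add: segment_convex_hull)
    then show "x \<in> (\<Union>u. \<Union>v. closed_segment (p u) (p v))"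
      by blast
  qed
  show "(\<Union>u. \<Union>v. closed_segment (p u) (p v)) \<subseteq> geometric_one_skeleton p K"
  proof clarify
    fix x u v assume x: "x \<in> closed_segment (p u) (p v)"
    have "{u, v} \<in> K"
    proof (cases "u = v")
      case True
      have "\<Union>K = UNIV"
        using graph by (simp add: one_skeleton_def complete_graph_def)
      then obtain s where "s \<in> K" "u \<in> s"
        by (metis UNIV_I UnionE)
      moreover from this have "{u} \<subseteq> s" "{u} \<noteq> {}"
        by auto
      ultimately have "{u} \<in> K"
        using K unfolding abstract_complex_def by blast
      then show ?thesis
        using True by simp
    next
      case False
      then have "{u, v} \<in> {e \<in> K. card e = 2}"
        using graph by (simp add: one_skeleton_def complete_graph_def)
      then show ?thesis
        by blast
    qed
    moreover have "card {u, v} \<le> 2"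
      by (simp add: card_insert_if)
    moreover have "x \<in> convex hull (p ` {u, v})"
      using x by (simp add: segment_convex_hull)
    ultimately show "x \<in> geometric_one_skeleton p K"
      unfolding geometric_one_skeleton_def by blast
  qed
qed

theorem theorem2:
  shows "\<forall>T \<in> triangulations_with_graph projective_plane (complete_graph (UNIV :: vertex set)).
           geometric_realization position T \<and>
           geometric_one_skeleton position T =
             (\<Union>u. \<Union>v. closed_segment (position u) (position v))"
proof
  fix T assume "T \<in> triangulations_with_graph projective_plane (complete_graph (UNIV :: vertex set))"
  then have T: "abstract_complex T" "two_dimensional T" "one_skeleton T = complete_graph UNIV"
    by (auto simp: triangulations_with_graph_def)
  have "card s \<le> 4" if "s \<in> T" for s
    using T(2) that by (force simp: two_dimensional_def)
  then have "geometric_realization position T"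
    by (intro geometric_realization_if_sign_imbalanced[OF sign_imbalanced_position])
      (simp_all add: finite_vertex)
  then show "geometric_realization position T \<and>
      geometric_one_skeleton position T = (\<Union>u. \<Union>v. closed_segment (position u) (position v))"
    using geometric_one_skeleton_complete_graph[OF T(1,3)] by blast
qed

end
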